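(* The category of zero-dimensional frames (and frame homomorphisms) and the category of strongly exact symmetric Frith frames are equivalent.
   Context: A frame is zero-dimensional if it is join-generated by its sublattice of complemented elements. A Frith frame is a pair $(L,S)$ where $L$ is a frame and $S$ is a bounded sublattice of $L$ that is join-dense (every element of $L$ is a join of elements of $S$). A morphism $(L,S)\to(M,T)$ is a frame homomorphism $h:L\to M$ with $h[S]\subseteq T$. $(L,S)$ is symmetric if $S$ is a Boolean algebra. For a frame $L$, $\mathcal C L$ is the frame of frame congruences on $L$ ordered by inclusion, and for $a\in L$, $\Delta_a=\{(x,y)\in L\times L\mid a\wedge x=a\wedge y\}\in\mathcal CL$. For $P\subseteq L$, the meet $\bigwedge P$ is strongly exact if the congruence $\bigvee_{s\in P}\Delta_s$ (join in $\mathcal CL$) equals $\Delta_a$ for some $a\in L$ (then necessarily $a=\bigwedge P$). The Frith frame $(L,S)$ is strongly exact if $\bigwedge P\in S$ for every $P\subseteq S$ such that the meet $\bigwedge P$ is strongly exact. Strongly exact symmetric Frith frames are regarded as a full subcategory of Frith frames. *)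

theory Defs
  imports "HOL-Algebra.Complete_Lattice" "HOL-Library.FuncSet"
begin

section \<open>Categories, functors and equivalence\<close>

text \<open>
  Arrows carry no built-in domain and codomain: \<open>Mor C X Y\<close> is the hom-set of arrows from
  \<open>X\<close> to \<open>Y\<close>, and hom-sets for different pairs of objects need not be disjoint. Therefore
  composition and the arrow part of a functor receive the objects as arguments:
  \<open>Comp C X Y Z g f\<close> is the composite \<open>g \<circ> f\<close> of \<open>f : X \<rightarrow> Y\<close> and \<open>g : Y \<rightarrow> Z\<close>.
\<close>

record ('o, 'm) cat =
  Ob :: "'o set"
  Mor :: "'o \<Rightarrow> 'o \<Rightarrow> 'm set"
  Ident :: "'o \<Rightarrow> 'm"
  Comp :: "'o \<Rightarrow> 'o \<Rightarrow> 'o \<Rightarrow> 'm \<Rightarrow> 'm \<Rightarrow> 'm"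

locale category =
  fixes C :: "('o, 'm) cat"
  assumes ident_mor: "X \<in> Ob C \<Longrightarrow> Ident C X \<in> Mor C X X"
    and comp_mor: "\<lbrakk>X \<in> Ob C; Y \<in> Ob C; Z \<in> Ob C; f \<in> Mor C X Y; g \<in> Mor C Y Z\<rbrakk>
      \<Longrightarrow> Comp C X Y Z g f \<in> Mor C X Z"
    and comp_ident_right: "\<lbrakk>X \<in> Ob C; Y \<in> Ob C; f \<in> Mor C X Y\<rbrakk>
      \<Longrightarrow> Comp C X X Y f (Ident C X) = f"
    and comp_ident_left: "\<lbrakk>X \<in> Ob C; Y \<in> Ob C; f \<in> Mor C X Y\<rbrakk>
      \<Longrightarrow> Comp C X Y Y (Ident C Y) f = f"
    and comp_assoc: "\<lbrakk>W \<in> Ob C; X \<in> Ob C; Y \<in> Ob C; Z \<in> Ob C;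
        f \<in> Mor C W X; g \<in> Mor C X Y; h \<in> Mor C Y Z\<rbrakk>
      \<Longrightarrow> Comp C W Y Z h (Comp C W X Y g f) = Comp C W X Z (Comp C X Y Z h g) f"

definition full_subcategory :: "('o, 'm) cat \<Rightarrow> ('o \<Rightarrow> bool) \<Rightarrow> ('o, 'm) cat" where
  "full_subcategory C P = C\<lparr>Ob := {X \<in> Ob C. P X}\<rparr>"

definition iso_arrow :: "('o, 'm) cat \<Rightarrow> 'o \<Rightarrow> 'o \<Rightarrow> 'm \<Rightarrow> bool" where
  "iso_arrow C X Y f \<longleftrightarrow> f \<in> Mor C X Y \<and>
     (\<exists>g \<in> Mor C Y X. Comp C X Y X g f = Ident C X \<and> Comp C Y X Y f g = Ident C Y)"

record ('o, 'm, 'p, 'n) fctr =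
  on_ob :: "'o \<Rightarrow> 'p"
  on_mor :: "'o \<Rightarrow> 'o \<Rightarrow> 'm \<Rightarrow> 'n"

definition is_functor :: "('o, 'm) cat \<Rightarrow> ('p, 'n) cat \<Rightarrow> ('o, 'm, 'p, 'n) fctr \<Rightarrow> bool" where
  "is_functor C D F \<longleftrightarrow>
     (\<forall>X \<in> Ob C. on_ob F X \<in> Ob D) \<and>
     (\<forall>X \<in> Ob C. \<forall>Y \<in> Ob C. \<forall>f \<in> Mor C X Y. on_mor F X Y f \<in> Mor D (on_ob F X) (on_ob F Y)) \<and>
     (\<forall>X \<in> Ob C. on_mor F X X (Ident C X) = Ident D (on_ob F X)) \<and>
     (\<forall>X \<in> Ob C. \<forall>Y \<in> Ob C. \<forall>Z \<in> Ob C. \<forall>f \<in> Mor C X Y. \<forall>g \<in> Mor C Y Z.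
        on_mor F X Z (Comp C X Y Z g f) =
          Comp D (on_ob F X) (on_ob F Y) (on_ob F Z) (on_mor F Y Z g) (on_mor F X Y f))"

definition id_functor :: "('o, 'm, 'o, 'm) fctr" where
  "id_functor = \<lparr>on_ob = (\<lambda>X. X), on_mor = (\<lambda>X Y f. f)\<rparr>"

definition comp_functor ::
  "('p, 'n, 'q, 'k) fctr \<Rightarrow> ('o, 'm, 'p, 'n) fctr \<Rightarrow> ('o, 'm, 'q, 'k) fctr" where
  "comp_functor G F =
     \<lparr>on_ob = (\<lambda>X. on_ob G (on_ob F X)),
      on_mor = (\<lambda>X Y f. on_mor G (on_ob F X) (on_ob F Y) (on_mor F X Y f))\<rparr>"

definition nat_iso :: "('o, 'm) cat \<Rightarrow> ('p, 'n) cat \<Rightarrow>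
    ('o, 'm, 'p, 'n) fctr \<Rightarrow> ('o, 'm, 'p, 'n) fctr \<Rightarrow> ('o \<Rightarrow> 'n) \<Rightarrow> bool" where
  "nat_iso C D F G \<eta> \<longleftrightarrow>
     (\<forall>X \<in> Ob C. iso_arrow D (on_ob F X) (on_ob G X) (\<eta> X)) \<and>
     (\<forall>X \<in> Ob C. \<forall>Y \<in> Ob C. \<forall>f \<in> Mor C X Y.
        Comp D (on_ob F X) (on_ob F Y) (on_ob G Y) (\<eta> Y) (on_mor F X Y f) =
        Comp D (on_ob F X) (on_ob G X) (on_ob G Y) (on_mor G X Y f) (\<eta> X))"

definition equivalent_categories :: "('o, 'm) cat \<Rightarrow> ('p, 'n) cat \<Rightarrow> bool" where
  "equivalent_categories C D \<longleftrightarrow> category C \<and> category D \<and>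
     (\<exists>F G \<eta> \<epsilon>. is_functor C D F \<and> is_functor D C G \<and>
        nat_iso C C id_functor (comp_functor G F) \<eta> \<and>
        nat_iso D D (comp_functor F G) id_functor \<epsilon>)"


section \<open>Frames\<close>

locale frame = complete_lattice L for L :: "'a gorder" (structure) +
  assumes inf_Sup_distrib: "\<lbrakk>x \<in> carrier L; A \<subseteq> carrier L\<rbrakk>
    \<Longrightarrow> x \<sqinter> (\<Squnion>A) = \<Squnion>{x \<sqinter> y | y. y \<in> A}"

text \<open>
  Homomorphisms are extensional functions (\<open>undefined\<close> outside the carrier), so that they are
  determined by their values on the carrier.
\<close>

definition frame_hom :: "'a gorder \<Rightarrow> 'b gorder \<Rightarrow> ('a \<Rightarrow> 'b) set" where
  "frame_hom L M = {h \<in> carrier L \<rightarrow>\<^sub>E carrier M.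
     h \<top>\<^bsub>L\<^esub> = \<top>\<^bsub>M\<^esub> \<and>
     (\<forall>x \<in> carrier L. \<forall>y \<in> carrier L. h (x \<sqinter>\<^bsub>L\<^esub> y) = h x \<sqinter>\<^bsub>M\<^esub> h y) \<and>
     (\<forall>A. A \<subseteq> carrier L \<longrightarrow> h (\<Squnion>\<^bsub>L\<^esub>A) = \<Squnion>\<^bsub>M\<^esub>(h ` A))}"

definition join_generated_by :: "'a gorder \<Rightarrow> 'a set \<Rightarrow> bool" where
  "join_generated_by L S \<longleftrightarrow> (\<forall>x \<in> carrier L. \<exists>P \<subseteq> S. x = \<Squnion>\<^bsub>L\<^esub>P)"

definition complemented :: "'a gorder \<Rightarrow> 'a \<Rightarrow> bool" where
  "complemented L x \<longleftrightarrow>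
     x \<in> carrier L \<and> (\<exists>y \<in> carrier L. x \<sqinter>\<^bsub>L\<^esub> y = \<bottom>\<^bsub>L\<^esub> \<and> x \<squnion>\<^bsub>L\<^esub> y = \<top>\<^bsub>L\<^esub>)"

definition zero_dimensional :: "'a gorder \<Rightarrow> bool" where
  "zero_dimensional L \<longleftrightarrow> join_generated_by L {x. complemented L x}"

text \<open>
  There being no proper classes in HOL, the type \<open>'a\<close> plays the role of the universe: the objects
  are all frames whose carrier is a set of elements of \<open>'a\<close>, where \<open>'a\<close> is arbitrary.
\<close>

definition Frame_cat :: "('a gorder, 'a \<Rightarrow> 'a) cat" where
  "Frame_cat = \<lparr>Ob = {L. frame L}, Mor = frame_hom,
     Ident = (\<lambda>L. restrict id (carrier L)),
     Comp = (\<lambda>L M N g f. compose (carrier L) g f)\<rparr>"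

definition ZeroDim_cat :: "('a gorder, 'a \<Rightarrow> 'a) cat" where
  "ZeroDim_cat = full_subcategory Frame_cat zero_dimensional"


section \<open>The frame of congruences\<close>

text \<open>
  A set \<open>R\<close> of related pairs stands for two families indexed by the same index set, so the last
  conjunct is compatibility with arbitrary joins.
\<close>

definition frame_congruence :: "'a gorder \<Rightarrow> ('a \<times> 'a) set \<Rightarrow> bool" where
  "frame_congruence L \<theta> \<longleftrightarrow> equiv (carrier L) \<theta> \<and>
     (\<forall>x y x' y'. (x, y) \<in> \<theta> \<longrightarrow> (x', y') \<in> \<theta> \<longrightarrow> (x \<sqinter>\<^bsub>L\<^esub> x', y \<sqinter>\<^bsub>L\<^esub> y') \<in> \<theta>) \<and>
     (\<forall>R \<subseteq> \<theta>. (\<Squnion>\<^bsub>L\<^esub>(fst ` R), \<Squnion>\<^bsub>L\<^esub>(snd ` R)) \<in> \<theta>)"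

definition Cong :: "'a gorder \<Rightarrow> ('a \<times> 'a) set gorder" where
  "Cong L = \<lparr>carrier = {\<theta>. frame_congruence L \<theta>}, eq = (=), le = (\<subseteq>)\<rparr>"

definition \<Delta> :: "'a gorder \<Rightarrow> 'a \<Rightarrow> ('a \<times> 'a) set" where
  "\<Delta> L a = {(x, y) \<in> carrier L \<times> carrier L. a \<sqinter>\<^bsub>L\<^esub> x = a \<sqinter>\<^bsub>L\<^esub> y}"

definition strongly_exact_meet :: "'a gorder \<Rightarrow> 'a set \<Rightarrow> bool" where
  "strongly_exact_meet L P \<longleftrightarrow> (\<exists>a \<in> carrier L. \<Squnion>\<^bsub>Cong L\<^esub>(\<Delta> L ` P) = \<Delta> L a)"


section \<open>Frith frames\<close>

definition bounded_sublattice :: "'a gorder \<Rightarrow> 'a set \<Rightarrow> bool" where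
  "bounded_sublattice L S \<longleftrightarrow> S \<subseteq> carrier L \<and> \<bottom>\<^bsub>L\<^esub> \<in> S \<and> \<top>\<^bsub>L\<^esub> \<in> S \<and>
     (\<forall>x \<in> S. \<forall>y \<in> S. x \<sqinter>\<^bsub>L\<^esub> y \<in> S \<and> x \<squnion>\<^bsub>L\<^esub> y \<in> S)"

definition Frith_frame :: "'a gorder \<times> 'a set \<Rightarrow> bool" where
  "Frith_frame = (\<lambda>(L, S). frame L \<and> bounded_sublattice L S \<and> join_generated_by L S)"

definition Frith_hom :: "'a gorder \<times> 'a set \<Rightarrow> 'b gorder \<times> 'b set \<Rightarrow> ('a \<Rightarrow> 'b) set" where
  "Frith_hom = (\<lambda>(L, S) (M, T). {h \<in> frame_hom L M. h ` S \<subseteq> T})"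

definition Frith_cat :: "('a gorder \<times> 'a set, 'a \<Rightarrow> 'a) cat" where
  "Frith_cat = \<lparr>Ob = {X. Frith_frame X}, Mor = Frith_hom,
     Ident = (\<lambda>X. restrict id (carrier (fst X))),
     Comp = (\<lambda>X Y Z g f. compose (carrier (fst X)) g f)\<rparr>"

definition is_boolean_algebra :: "'a gorder \<Rightarrow> bool" where
  "is_boolean_algebra B \<longleftrightarrow> bounded_lattice B \<and>
     (\<forall>x \<in> carrier B. \<forall>y \<in> carrier B. \<forall>z \<in> carrier B.
        x \<sqinter>\<^bsub>B\<^esub> (y \<squnion>\<^bsub>B\<^esub> z) = (x \<sqinter>\<^bsub>B\<^esub> y) \<squnion>\<^bsub>B\<^esub> (x \<sqinter>\<^bsub>B\<^esub> z)) \<and>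
     (\<forall>x \<in> carrier B. complemented B x)"

text \<open>Here \<open>L\<lparr>carrier := S\<rparr>\<close> is \<open>S\<close> with the order induced from \<open>L\<close>.\<close>

definition symmetric :: "'a gorder \<times> 'a set \<Rightarrow> bool" where
  "symmetric = (\<lambda>(L, S). is_boolean_algebra (L\<lparr>carrier := S\<rparr>))"

definition strongly_exact :: "'a gorder \<times> 'a set \<Rightarrow> bool" where
  "strongly_exact = (\<lambda>(L, S). \<forall>P \<subseteq> S. strongly_exact_meet L P \<longrightarrow> \<Sqinter>\<^bsub>L\<^esub>P \<in> S)"

definition SESymFrith_cat :: "('a gorder \<times> 'a set, 'a \<Rightarrow> 'a) cat" where
  "SESymFrith_cat = full_subcategory Frith_cat (\<lambda>X. strongly_exact X \<and> symmetric X)"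

end

theory Submission
  imports Defs
begin

text \<open>
  Why the equivalence holds. Write \<open>B(L)\<close> for the set of complemented elements of a frame \<open>L\<close>.
  A Frith frame \<open>(L, S)\<close> that is symmetric and strongly exact carries no information beyond \<open>L\<close>:
  necessarily \<open>S = B(L)\<close>. Conversely \<open>(L, B(L))\<close> is symmetric and strongly exact for every
  frame \<open>L\<close>, and it is a Frith frame exactly when \<open>L\<close> is zero-dimensional. As frame homomorphisms
  preserve complements, \<open>L \<mapsto> (L, B(L))\<close> and \<open>(L, S) \<mapsto> L\<close>, both acting as the identity on arrows,
  are functors inverse to each other.

  The one step with content is to recognise which meets of complemented elements are strongly
  exact. Besides the open congruence \<open>\<Delta> L a\<close> consider the closed congruence
  \<open>nabla L d = {(x, y). d \<squnion> x = d \<squnion> y}\<close>, the least congruence that identifies \<open>d\<close> with \<open>\<bottom>\<close>. Three facts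
  settle the matter.

  \<^item> \<open>a\<close> and \<open>d\<close> are complements of each other iff \<open>\<Delta> L a = nabla L d\<close>
    (\<open>is_complement_iff_Delta_eq_nabla\<close>).
  \<^item> Closed congruences turn joins in \<open>L\<close> into joins of congruences: the join of the \<open>nabla L t\<close>,
    \<open>t \<in> T\<close>, is \<open>nabla L (\<Squnion>T)\<close> (\<open>Cong_Sup_nabla\<close>).
  \<^item> If \<open>\<Squnion>T\<close> has a complement, that complement is the meet of the complements of the elements of \<open>T\<close>
    (\<open>Inf_eq_complement_of_Sup\<close>).

  So if \<open>P\<close> consists of complemented elements and \<open>T\<close> of their complements, the join of the
  \<open>\<Delta> L s\<close>, \<open>s \<in> P\<close>, is \<open>nabla L (\<Squnion>T)\<close>, and the meet of \<open>P\<close> is strongly exact iff \<open>\<Squnion>T\<close> has a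
  complement, which is then \<open>\<Sqinter>P\<close> (\<open>strongly_exact_meet_iff\<close>). In particular strongly exact meets
  of complemented elements are complemented. And if \<open>S\<close> is a join-dense Boolean sublattice, a
  complemented \<open>c\<close> has a complement of the form \<open>\<Squnion>T\<close> with \<open>T \<subseteq> S\<close>, so \<open>c\<close> is a strongly exact meet
  of elements of \<open>S\<close>; strong exactness puts it into \<open>S\<close>.
\<close>

section \<open>Complements and joins in a frame\<close>

definition is_complement :: "'a gorder \<Rightarrow> 'a \<Rightarrow> 'a \<Rightarrow> bool" where
  "is_complement L x y \<longleftrightarrow> x \<in> carrier L \<and> y \<in> carrier L \<and>
     x \<sqinter>\<^bsub>L\<^esub> y = \<bottom>\<^bsub>L\<^esub> \<and> x \<squnion>\<^bsub>L\<^esub> y = \<top>\<^bsub>L\<^esub>"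

definition complemented_elements :: "'a gorder \<Rightarrow> 'a set" where
  "complemented_elements L = {x. complemented L x}"

lemma complemented_iff: "complemented L x \<longleftrightarrow> (\<exists>y. is_complement L x y)"
  by (auto simp: complemented_def is_complement_def)

lemma mem_complemented_elements: "x \<in> complemented_elements L \<longleftrightarrow> (\<exists>y. is_complement L x y)"
  by (simp add: complemented_elements_def complemented_iff)

lemma is_complement_sym: "is_complement L x y \<Longrightarrow> is_complement L y x"
  by (metis is_complement_def join_comm meet_comm)

context frame
begin

lemma le_iff_meet_eq: "\<lbrakk>x \<in> carrier L; y \<in> carrier L\<rbrakk> \<Longrightarrow> x \<sqsubseteq> y \<longleftrightarrow> x \<sqinter> y = x"
  using le_iff_join by metis

lemma le_joinI1: "\<lbrakk>z \<sqsubseteq> x; x \<in> carrier L; y \<in> carrier L; z \<in> carrier L\<rbrakk> \<Longrightarrow> z \<sqsubseteq> x \<squnion> y"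
  using le_trans[of z x "x \<squnion> y"] join_left[of x y] by simp

lemma le_joinI2: "\<lbrakk>z \<sqsubseteq> y; x \<in> carrier L; y \<in> carrier L; z \<in> carrier L\<rbrakk> \<Longrightarrow> z \<sqsubseteq> x \<squnion> y"
  using le_joinI1[of z y x] by (simp add: join_comm)

lemma meet_leI1: "\<lbrakk>x \<sqsubseteq> z; x \<in> carrier L; y \<in> carrier L; z \<in> carrier L\<rbrakk> \<Longrightarrow> x \<sqinter> y \<sqsubseteq> z"
  using le_trans[of "x \<sqinter> y" x z] meet_left[of x y] by simp

lemma meet_leI2: "\<lbrakk>y \<sqsubseteq> z; x \<in> carrier L; y \<in> carrier L; z \<in> carrier L\<rbrakk> \<Longrightarrow> x \<sqinter> y \<sqsubseteq> z"
  using meet_leI1[of y z x] by (simp add: meet_comm)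

lemma meet_join_distrib:
  assumes "x \<in> carrier L" "y \<in> carrier L" "z \<in> carrier L"
  shows "x \<sqinter> (y \<squnion> z) = (x \<sqinter> y) \<squnion> (x \<sqinter> z)"
proof -
  have "{x \<sqinter> w | w. w \<in> {y, z}} = {x \<sqinter> y, x \<sqinter> z}" by auto
  then show ?thesis
    using inf_Sup_distrib[of x "{y, z}"] assms by (simp add: join_def)
qed

text \<open>
  The frame law only gives that meets distribute over joins; as in every lattice, the dual law for
  binary operations follows.
\<close>

lemma join_meet_distrib:
  assumes "x \<in> carrier L" "y \<in> carrier L" "z \<in> carrier L"
  shows "x \<squnion> (y \<sqinter> z) = (x \<squnion> y) \<sqinter> (x \<squnion> z)"
proof (rule le_antisym)
  show "x \<squnion> (y \<sqinter> z) \<sqsubseteq> (x \<squnion> y) \<sqinter> (x \<squnion> z)"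
    using assms by (intro join_le meet_le join_left) (auto intro: le_joinI2 meet_left meet_right)
  have "(x \<squnion> y) \<sqinter> (x \<squnion> z) = ((x \<squnion> y) \<sqinter> x) \<squnion> ((x \<squnion> y) \<sqinter> z)"
    using assms by (intro meet_join_distrib) auto
  also have "(x \<squnion> y) \<sqinter> z = (x \<sqinter> z) \<squnion> (y \<sqinter> z)"
    using meet_join_distrib[of z x y] assms by (simp add: meet_comm)
  finally have eq: "(x \<squnion> y) \<sqinter> (x \<squnion> z) = ((x \<squnion> y) \<sqinter> x) \<squnion> ((x \<sqinter> z) \<squnion> (y \<sqinter> z))" .
  have x_le: "x \<sqsubseteq> x \<squnion> (y \<sqinter> z)" and "y \<sqinter> z \<sqsubseteq> x \<squnion> (y \<sqinter> z)"
    using assms by (auto intro: join_left join_right)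
  moreover have "(x \<squnion> y) \<sqinter> x \<sqsubseteq> x \<squnion> (y \<sqinter> z)"
    using assms by (intro meet_leI2[OF x_le]) auto
  moreover have "x \<sqinter> z \<sqsubseteq> x \<squnion> (y \<sqinter> z)"
    using assms by (intro meet_leI1[OF x_le]) auto
  ultimately show "(x \<squnion> y) \<sqinter> (x \<squnion> z) \<sqsubseteq> x \<squnion> (y \<sqinter> z)"
    unfolding eq using assms by (intro join_le) auto
qed (use assms in auto)

lemma bottom_meet_eq [simp]: "x \<in> carrier L \<Longrightarrow> \<bottom> \<sqinter> x = \<bottom>"
  using bottom_meet by (simp add: eq_is_equal)

lemma meet_bottom_eq [simp]: "x \<in> carrier L \<Longrightarrow> x \<sqinter> \<bottom> = \<bottom>"
  by (simp add: meet_comm[of L x])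

lemma bottom_join_eq [simp]: "x \<in> carrier L \<Longrightarrow> \<bottom> \<squnion> x = x"
  using bottom_join by (simp add: eq_is_equal)

lemma join_bottom_eq [simp]: "x \<in> carrier L \<Longrightarrow> x \<squnion> \<bottom> = x"
  by (simp add: join_comm[of L x])

lemma top_join_eq [simp]: "x \<in> carrier L \<Longrightarrow> \<top> \<squnion> x = \<top>"
  using top_join by (simp add: eq_is_equal)

lemma join_top_eq [simp]: "x \<in> carrier L \<Longrightarrow> x \<squnion> \<top> = \<top>"
  by (simp add: join_comm[of L x])

lemma top_meet_eq [simp]: "x \<in> carrier L \<Longrightarrow> \<top> \<sqinter> x = x"
  using top_meet by (simp add: eq_is_equal)

lemma meet_top_eq [simp]: "x \<in> carrier L \<Longrightarrow> x \<sqinter> \<top> = x"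
  by (simp add: meet_comm[of L x])

lemma join_idem [simp]: "x \<in> carrier L \<Longrightarrow> x \<squnion> x = x"
  by (simp add: join_def)

lemma meet_idem [simp]: "x \<in> carrier L \<Longrightarrow> x \<sqinter> x = x"
  by (simp add: meet_def)

lemma sup_empty_eq: "\<Squnion>{} = \<bottom>"
  using weak_sup_empty by (simp add: eq_is_equal)

lemma bottom_unique: "\<lbrakk>x \<in> carrier L; x \<sqsubseteq> \<bottom>\<rbrakk> \<Longrightarrow> x = \<bottom>"
  by (intro le_antisym) auto

lemma is_complement_bottom_top: "is_complement L \<bottom> \<top>"
  by (simp add: is_complement_def)

lemma is_complement_meet_join:
  assumes "is_complement L x x'" "is_complement L y y'"
  shows "is_complement L (x \<sqinter> y) (x' \<squnion> y')"
proof -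
  note c = assms[unfolded is_complement_def]
  have "(x \<sqinter> y) \<sqinter> x' = \<bottom>" "(x \<sqinter> y) \<sqinter> y' = \<bottom>"
    using c by (metis meet_assoc meet_comm bottom_meet_eq)+
  then have "(x \<sqinter> y) \<sqinter> (x' \<squnion> y') = \<bottom>"
    using c by (simp add: meet_join_distrib)
  moreover have "(x' \<squnion> y') \<squnion> x = \<top>" "(x' \<squnion> y') \<squnion> y = \<top>"
    using c by (metis join_assoc join_comm top_join_eq)+
  then have "(x \<sqinter> y) \<squnion> (x' \<squnion> y') = \<top>"
    using c by (simp add: join_comm[of L "x \<sqinter> y"] join_meet_distrib)
  ultimately show ?thesis using c by (simp add: is_complement_def)
qed

lemma bounded_sublattice_complemented_elements:
  "bounded_sublattice L (complemented_elements L)"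
  unfolding bounded_sublattice_def
proof (intro conjI ballI)
  show "complemented_elements L \<subseteq> carrier L"
    by (auto simp: mem_complemented_elements is_complement_def)
  show "\<bottom> \<in> complemented_elements L" "\<top> \<in> complemented_elements L"
    using is_complement_bottom_top is_complement_sym mem_complemented_elements by metis+
  fix x y assume "x \<in> complemented_elements L" "y \<in> complemented_elements L"
  then show "x \<sqinter> y \<in> complemented_elements L" "x \<squnion> y \<in> complemented_elements L"
    unfolding mem_complemented_elements
    using is_complement_meet_join is_complement_sym by metis+
qed


end


section \<open>Closed congruences and strongly exact meets of complemented elements\<close>

text \<open>
  The closed congruence of \<open>a\<close>: its quotient is the sublocale complementary to the open one
  given by \<open>\<Delta> L a\<close>.
\<close>

definition nabla :: "'a gorder \<Rightarrow> 'a \<Rightarrow> ('a \<times> 'a) set" where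
  "nabla L a = {(x, y) \<in> carrier L \<times> carrier L. a \<squnion>\<^bsub>L\<^esub> x = a \<squnion>\<^bsub>L\<^esub> y}"

lemma frame_congruence_Sup:
  "\<lbrakk>frame_congruence L \<theta>; R \<subseteq> \<theta>\<rbrakk> \<Longrightarrow> (\<Squnion>\<^bsub>L\<^esub>(fst ` R), \<Squnion>\<^bsub>L\<^esub>(snd ` R)) \<in> \<theta>"
  by (simp add: frame_congruence_def)

lemma frame_congruence_join:
  "\<lbrakk>frame_congruence L \<theta>; (x, y) \<in> \<theta>; (x', y') \<in> \<theta>\<rbrakk>
    \<Longrightarrow> (x \<squnion>\<^bsub>L\<^esub> x', y \<squnion>\<^bsub>L\<^esub> y') \<in> \<theta>"
  using frame_congruence_Sup[of L \<theta> "{(x, y), (x', y')}"] by (simp add: join_def)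

text \<open>
  The join in \<open>Cong L\<close> is a choice among least upper bounds for inclusion. These are unique, so a
  congruence recognised as a least upper bound is the join.
\<close>

lemma Cong_Sup_eqI:
  assumes "frame_congruence L \<theta>"
    and "\<And>\<phi>. \<phi> \<in> A \<Longrightarrow> frame_congruence L \<phi>"
    and "\<And>\<phi>. \<phi> \<in> A \<Longrightarrow> \<phi> \<subseteq> \<theta>"
    and "\<And>\<psi>. \<lbrakk>frame_congruence L \<psi>; \<And>\<phi>. \<phi> \<in> A \<Longrightarrow> \<phi> \<subseteq> \<psi>\<rbrakk> \<Longrightarrow> \<theta> \<subseteq> \<psi>"
  shows "\<Squnion>\<^bsub>Cong L\<^esub>A = \<theta>"
proof -
  have "least (Cong L) \<theta> (Upper (Cong L) A)"
    using assms by (auto simp: least_def Upper_def Cong_def)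
  moreover have "\<theta>' = \<theta>" if "least (Cong L) \<theta>' (Upper (Cong L) A)" for \<theta>'
    using that \<open>least (Cong L) \<theta> _\<close> by (auto simp: least_def Cong_def)
  ultimately show ?thesis
    unfolding Lattice.sup_def by (rule some_equality)
qed

context frame
begin

text \<open>
  Compatibility with binary meets is distributivity of joins over meets. For arbitrary joins,
  \<open>a \<squnion> \<Squnion>X\<close> is determined by the elements \<open>a \<squnion> x\<close>; it is compared with \<open>a \<squnion> \<Squnion>Y\<close> by two inequalities,
  which also covers empty families, where \<open>a \<squnion> \<Squnion>{}\<close> is \<open>a\<close> and not an empty join.
\<close>

lemma frame_congruence_nabla:
  assumes a: "a \<in> carrier L"
  shows "frame_congruence L (nabla L a)"
  unfolding frame_congruence_def
proof (intro conjI allI impI)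
  show "equiv (carrier L) (nabla L a)"
    by (auto simp: nabla_def equiv_def refl_on_def sym_def trans_def)
next
  fix x y x' y' assume "(x, y) \<in> nabla L a" "(x', y') \<in> nabla L a"
  then show "(x \<sqinter> x', y \<sqinter> y') \<in> nabla L a"
    using a by (simp add: nabla_def join_meet_distrib)
next
  fix R assume R: "R \<subseteq> nabla L a"
  have le: "a \<squnion> \<Squnion>(f ` R) \<sqsubseteq> a \<squnion> \<Squnion>(g ` R)"
    if f: "f ` R \<subseteq> carrier L" and g: "g ` R \<subseteq> carrier L"
      and eq: "\<And>r. r \<in> R \<Longrightarrow> a \<squnion> f r = a \<squnion> g r" for f g :: "'a \<times> 'a \<Rightarrow> 'a"
  proof (intro join_le sup_least join_left)
    fix x assume "x \<in> f ` R"
    then obtain r where r: "r \<in> R" "x = f r" by auto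
    then have in_L: "f r \<in> carrier L" "g r \<in> carrier L" using f g by auto
    have "f r \<sqsubseteq> a \<squnion> g r"
      using join_right[OF a in_L(1)] eq[OF r(1)] by simp
    also have "a \<squnion> g r \<sqsubseteq> a \<squnion> \<Squnion>(g ` R)"
      using a g in_L r(1) by (intro join_le join_left le_joinI2 sup_upper) auto
    finally show "x \<sqsubseteq> a \<squnion> \<Squnion>(g ` R)"
      using r a g in_L by simp
  qed (use a f g in auto)
  have "fst ` R \<subseteq> carrier L" "snd ` R \<subseteq> carrier L"
    and "\<And>r. r \<in> R \<Longrightarrow> a \<squnion> fst r = a \<squnion> snd r"
    using R by (auto simp: nabla_def)
  then show "(\<Squnion>(fst ` R), \<Squnion>(snd ` R)) \<in> nabla L a"
    using a le[of fst snd] le[of snd fst] by (auto simp: nabla_def)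
qed

text \<open>
  \<open>nabla L a\<close> is generated by the single pair \<open>(a, \<bottom>)\<close>: modulo a congruence that contains this
  pair, \<open>a \<squnion> x\<close> is equivalent to \<open>\<bottom> \<squnion> x = x\<close>, so \<open>a \<squnion> x = a \<squnion> y\<close> forces \<open>x\<close> and \<open>y\<close> to be equivalent.
\<close>

lemma nabla_subset_iff:
  assumes "frame_congruence L \<theta>" "a \<in> carrier L"
  shows "nabla L a \<subseteq> \<theta> \<longleftrightarrow> (a, \<bottom>) \<in> \<theta>"
proof
  assume "nabla L a \<subseteq> \<theta>"
  then show "(a, \<bottom>) \<in> \<theta>"
    using assms by (auto simp: nabla_def)
next
  assume *: "(a, \<bottom>) \<in> \<theta>"
  have equiv: "equiv (carrier L) \<theta>"
    using assms by (simp add: frame_congruence_def)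
  have absorb: "(a \<squnion> x, x) \<in> \<theta>" if "x \<in> carrier L" for x
  proof -
    have "(x, x) \<in> \<theta>" using equiv that by (simp add: equiv_def refl_on_def)
    then show ?thesis
      using frame_congruence_join[OF assms(1) * \<open>(x, x) \<in> \<theta>\<close>] that by simp
  qed
  show "nabla L a \<subseteq> \<theta>"
  proof (clarsimp simp: nabla_def)
    fix x y assume "x \<in> carrier L" "y \<in> carrier L" "a \<squnion> x = a \<squnion> y"
    then show "(x, y) \<in> \<theta>"
      using absorb[of x] absorb[of y] equiv by (metis equivE symE transE)
  qed
qed

text \<open>
  By the previous lemma, a congruence contains all \<open>nabla L t\<close>, \<open>t \<in> T\<close>, iff it identifies every \<open>t \<in> T\<close>
  with \<open>\<bottom>\<close>; as it is compatible with joins, this means that it identifies \<open>\<Squnion>T\<close> with \<open>\<bottom>\<close>. The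
  analogous statement for the open congruences \<open>\<Delta> L a\<close> and meets fails in general: this failure is
  what strong exactness is about.
\<close>

lemma Cong_Sup_nabla:
  assumes T: "T \<subseteq> carrier L"
  shows "\<Squnion>\<^bsub>Cong L\<^esub>(nabla L ` T) = nabla L (\<Squnion>T)"
proof (rule Cong_Sup_eqI)
  show "frame_congruence L (nabla L (\<Squnion>T))"
    using T by (simp add: frame_congruence_nabla)
  show "frame_congruence L \<phi>" if "\<phi> \<in> nabla L ` T" for \<phi>
    using that T by (auto intro: frame_congruence_nabla)
  show "\<phi> \<subseteq> nabla L (\<Squnion>T)" if \<phi>: "\<phi> \<in> nabla L ` T" for \<phi>
  proof -
    obtain t where t: "t \<in> T" "\<phi> = nabla L t" using \<phi> by blast
    then have "\<Squnion>T \<squnion> t = \<Squnion>T"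
      using T by (metis join_comm le_iff_meet subsetD sup_closed sup_upper)
    then have "(t, \<bottom>) \<in> nabla L (\<Squnion>T)"
      using t T by (auto simp: nabla_def)
    then show ?thesis
      using t(2) nabla_subset_iff[OF frame_congruence_nabla, of "\<Squnion>T" t] t(1) T
      by (simp add: subset_iff)
  qed
  show "nabla L (\<Squnion>T) \<subseteq> \<psi>"
    if \<psi>: "frame_congruence L \<psi>" and above: "\<And>\<phi>. \<phi> \<in> nabla L ` T \<Longrightarrow> \<phi> \<subseteq> \<psi>" for \<psi>
  proof -
    have "(t, \<bottom>) \<in> \<psi>" if t: "t \<in> T" for t
      using above[OF imageI[OF t]] t T nabla_subset_iff[OF \<psi>] by (simp add: subset_iff)
    then have "T \<times> {\<bottom>} \<subseteq> \<psi>"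
      by blast
    \<comment> \<open>The second family is constantly \<open>\<bottom>\<close>, or empty if \<open>T\<close> is; its join is \<open>\<bottom>\<close> in both cases.\<close>
    then have "(\<Squnion>(fst ` (T \<times> {\<bottom>})), \<Squnion>(snd ` (T \<times> {\<bottom>}))) \<in> \<psi>"
      by (rule frame_congruence_Sup[OF \<psi>])
    moreover have "\<Squnion>(snd ` (T \<times> {\<bottom>})) = \<bottom>"
      by (cases "T = {}") (simp_all add: sup_empty_eq)
    ultimately have "(\<Squnion>T, \<bottom>) \<in> \<psi>"
      by simp
    then show ?thesis
      using \<psi> T by (simp add: nabla_subset_iff)
  qed
qed

text \<open>
  If \<open>a\<close> and \<open>d\<close> are complements, then \<open>a \<sqinter> z\<close> and \<open>d \<squnion> z\<close> determine each other, since
  \<open>d \<squnion> (a \<sqinter> z) = d \<squnion> z\<close> and \<open>a \<sqinter> (d \<squnion> z) = a \<sqinter> z\<close>. Conversely, \<open>nabla L d\<close> always contains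
  \<open>(d, \<bottom>)\<close>, and \<open>\<Delta> L a\<close> always contains \<open>(\<top>, a)\<close>; reading each pair in the other congruence gives the two
  equations
  of a complement.
\<close>

lemma is_complement_iff_Delta_eq_nabla:
  assumes "a \<in> carrier L" "d \<in> carrier L"
  shows "is_complement L a d \<longleftrightarrow> \<Delta> L a = nabla L d"
proof
  assume "is_complement L a d"
  then have meet: "a \<sqinter> d = \<bottom>" and join: "d \<squnion> a = \<top>"
    by (simp_all add: is_complement_def join_comm)
  have "a \<sqinter> x = a \<sqinter> y \<longleftrightarrow> d \<squnion> x = d \<squnion> y"
    if "x \<in> carrier L" "y \<in> carrier L" for x y
  proof -
    have "d \<squnion> (a \<sqinter> z) = d \<squnion> z" "a \<sqinter> (d \<squnion> z) = a \<sqinter> z" if "z \<in> carrier L" for z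
      using assms that by (simp_all add: join_meet_distrib meet_join_distrib meet join)
    then show ?thesis
      using that by metis
  qed
  then show "\<Delta> L a = nabla L d"
    by (auto simp: \<Delta>_def nabla_def)
next
  assume eq: "\<Delta> L a = nabla L d"
  have "(d, \<bottom>) \<in> nabla L d" using assms by (simp add: nabla_def)
  then have "a \<sqinter> d = \<bottom>" using assms unfolding eq[symmetric] by (simp add: \<Delta>_def)
  moreover have "(\<top>, a) \<in> \<Delta> L a" using assms by (simp add: \<Delta>_def)
  then have "d \<squnion> a = \<top>" using assms unfolding eq by (simp add: nabla_def)
  ultimately show "is_complement L a d"
    using assms by (simp add: is_complement_def join_comm)
qed

text \<open>
  Complements are unique, so this says that \<open>T = {complement of s | s \<in> P}\<close>. The relational form is
  symmetric in \<open>P\<close> and \<open>T\<close>: below, \<open>P\<close> is given in one application and \<open>T\<close> in the other.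
\<close>

definition elementwise_complements :: "'a set \<Rightarrow> 'a set \<Rightarrow> bool" where
  "elementwise_complements P T \<longleftrightarrow>
     (\<forall>s \<in> P. \<exists>t \<in> T. is_complement L s t) \<and> (\<forall>t \<in> T. \<exists>s \<in> P. is_complement L s t)"

lemma elementwise_complements_closed:
  assumes "elementwise_complements P T"
  shows "P \<subseteq> carrier L" "T \<subseteq> carrier L"
  using assms by (auto simp: elementwise_complements_def is_complement_def)

text \<open>
  The congruences \<open>\<Delta> L s\<close>, \<open>s \<in> P\<close>, are the closed congruences of the complements \<open>t \<in> T\<close>. Hence their
  join is \<open>nabla L (\<Squnion>T)\<close>, and a closed congruence is of the form \<open>\<Delta> L a\<close> only for a complement \<open>a\<close>.
\<close>

lemma strongly_exact_meet_iff:
  assumes PT: "elementwise_complements P T"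
  shows "strongly_exact_meet L P \<longleftrightarrow> (\<exists>a. is_complement L a (\<Squnion>T))"
proof -
  have T: "T \<subseteq> carrier L" by (rule elementwise_complements_closed[OF PT])
  have "\<Delta> L ` P = nabla L ` T"
    using PT unfolding elementwise_complements_def image_def
    by (metis (no_types, lifting) is_complement_def is_complement_iff_Delta_eq_nabla)
  then have "\<Squnion>\<^bsub>Cong L\<^esub>(\<Delta> L ` P) = nabla L (\<Squnion>T)"
    using Cong_Sup_nabla[OF T] by simp
  then show ?thesis
    using T is_complement_iff_Delta_eq_nabla[of _ "\<Squnion>T"]
    unfolding strongly_exact_meet_def by (metis is_complement_def sup_closed)
qed

text \<open>
  The infinite De Morgan law. In a frame, the meet \<open>b\<close> of \<open>P\<close> is disjoint from every \<open>t \<in> T\<close>, hence from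
  \<open>\<Squnion>T\<close>; if \<open>\<Squnion>T\<close> has a complement \<open>a\<close>, this puts \<open>b\<close> below \<open>a\<close>.
\<close>

lemma Inf_eq_complement_of_Sup:
  assumes PT: "elementwise_complements P T" and a: "is_complement L a (\<Squnion>T)"
  shows "\<Sqinter>P = a"
proof -
  note closed = elementwise_complements_closed[OF PT]
  have in_L: "a \<in> carrier L" and meet: "a \<sqinter> \<Squnion>T = \<bottom>" and join: "a \<squnion> \<Squnion>T = \<top>"
    using a by (simp_all add: is_complement_def)
  show ?thesis
  proof (rule le_antisym)
    show "a \<sqsubseteq> \<Sqinter>P"
    proof (rule inf_greatest)
      fix s assume "s \<in> P"
      then obtain t where t: "t \<in> T" and st: "is_complement L s t"
        using PT unfolding elementwise_complements_def by meson
      then have L: "s \<in> carrier L" "t \<in> carrier L" and st_join: "s \<squnion> t = \<top>"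
        by (simp_all add: is_complement_def)
      have "a \<sqinter> t \<sqsubseteq> a \<sqinter> \<Squnion>T"
        using L t in_L closed(2) by (intro meet_le meet_left meet_leI2 sup_upper) auto
      then have "a \<sqinter> t = \<bottom>"
        using meet L in_L by (simp add: bottom_unique)
      moreover have "a = (a \<sqinter> s) \<squnion> (a \<sqinter> t)"
        using L in_L st_join by (simp add: meet_join_distrib[symmetric])
      ultimately show "a \<sqsubseteq> s"
        using L in_L by (simp add: le_iff_meet_eq)
    qed (use closed in_L in auto)
    let ?b = "\<Sqinter>P"
    have b: "?b \<in> carrier L" using closed by simp
    have bt: "?b \<sqinter> t = \<bottom>" if t: "t \<in> T" for t
    proof -
      obtain s where "s \<in> P" and st: "is_complement L s t"
        using PT t unfolding elementwise_complements_def by meson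
      then have "?b \<sqsubseteq> s" using closed inf_lower by simp
      moreover have "s \<in> carrier L" "t \<in> carrier L" "s \<sqinter> t = \<bottom>"
        using st by (simp_all add: is_complement_def)
      ultimately show ?thesis
        using b meet_assoc[of ?b s t] by (simp add: le_iff_meet_eq)
    qed
    have "{?b \<sqinter> t | t. t \<in> T} \<subseteq> {\<bottom>}"
      by (clarify, simp add: bt)
    then have "\<Squnion>{?b \<sqinter> t | t. t \<in> T} \<sqsubseteq> \<bottom>" "\<Squnion>{?b \<sqinter> t | t. t \<in> T} \<in> carrier L"
      by (intro sup_least sup_closed; fastforce)+
    then have "\<Squnion>{?b \<sqinter> t | t. t \<in> T} = \<bottom>"
      by (intro bottom_unique)
    then have "?b \<sqinter> \<Squnion>T = \<bottom>"
      using inf_Sup_distrib[OF b closed(2)] by simp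
    then have "?b = ?b \<sqinter> a"
      using meet_join_distrib[of ?b a "\<Squnion>T"] b in_L closed join by simp
    then show "?b \<sqsubseteq> a"
      using b in_L le_iff_meet_eq by metis
  qed (use closed in_L in auto)
qed

end


section \<open>Symmetric Frith frames\<close>

lemma (in partial_order) partial_order_subset:
  assumes "S \<subseteq> carrier L" shows "partial_order (L\<lparr>carrier := S\<rparr>)"
proof -
  interpret sub: weak_partial_order "L\<lparr>carrier := S\<rparr>"
    using assms by (rule weak_partial_order_subset[OF weak_partial_order_axioms])
  show ?thesis
    by unfold_locales (simp add: eq_is_equal)
qed

context frame
begin

text \<open>
  Symmetry of \<open>(L, S)\<close> speaks of \<open>S\<close> with the induced order, whose operations are defined anew from
  that order. For a bounded sublattice they agree with those of \<open>L\<close>.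
\<close>

lemma sublattice_ops:
  assumes S: "bounded_sublattice L S"
  shows "bounded_lattice (L\<lparr>carrier := S\<rparr>)"
    and "\<lbrakk>x \<in> S; y \<in> S\<rbrakk> \<Longrightarrow> x \<sqinter>\<^bsub>L\<lparr>carrier := S\<rparr>\<^esub> y = x \<sqinter> y"
    and "\<lbrakk>x \<in> S; y \<in> S\<rbrakk> \<Longrightarrow> x \<squnion>\<^bsub>L\<lparr>carrier := S\<rparr>\<^esub> y = x \<squnion> y"
    and "\<bottom>\<^bsub>L\<lparr>carrier := S\<rparr>\<^esub> = \<bottom>"
    and "\<top>\<^bsub>L\<lparr>carrier := S\<rparr>\<^esub> = \<top>"
proof -
  let ?B = "L\<lparr>carrier := S\<rparr>"
  have S_closed: "S \<subseteq> carrier L" and "\<bottom> \<in> S" "\<top> \<in> S"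
    and op_closed: "\<And>x y. \<lbrakk>x \<in> S; y \<in> S\<rbrakk> \<Longrightarrow> x \<sqinter> y \<in> S \<and> x \<squnion> y \<in> S"
    using S by (auto simp: bounded_sublattice_def)
  interpret sub: partial_order ?B
    using S_closed by (rule partial_order_subset)
  have glb: "greatest ?B (x \<sqinter> y) (Lower ?B {x, y})" if "x \<in> S" "y \<in> S" for x y
    using that op_closed subsetD[OF S_closed]
    by (auto simp: greatest_def Lower_def intro: meet_left meet_right meet_le)
  have lub: "least ?B (x \<squnion> y) (Upper ?B {x, y})" if "x \<in> S" "y \<in> S" for x y
    using that op_closed subsetD[OF S_closed]
    by (auto simp: least_def Upper_def intro: join_left join_right join_le)
  have bot: "least ?B \<bottom> (carrier ?B)"
    using S_closed \<open>\<bottom> \<in> S\<close> by (auto simp: least_def)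
  have top: "greatest ?B \<top> (carrier ?B)"
    using S_closed \<open>\<top> \<in> S\<close> by (auto simp: greatest_def)
  show "bounded_lattice ?B"
  proof unfold_locales
    fix x y assume "x \<in> carrier ?B" "y \<in> carrier ?B"
    then have xy: "x \<in> S" "y \<in> S" by simp_all
    show "\<exists>s. least ?B s (Upper ?B {x, y})" by (rule exI, rule lub[OF xy])
    show "\<exists>s. greatest ?B s (Lower ?B {x, y})" by (rule exI, rule glb[OF xy])
  qed (rule exI, rule bot, rule exI, rule top)
  show "x \<sqinter>\<^bsub>?B\<^esub> y = x \<sqinter> y" if "x \<in> S" "y \<in> S"
    unfolding meet_def[of ?B] Lattice.inf_def[of ?B]
    using glb[OF that] sub.greatest_unique by (blast intro: some_equality)
  show "x \<squnion>\<^bsub>?B\<^esub> y = x \<squnion> y" if "x \<in> S" "y \<in> S"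
    unfolding join_def[of ?B] Lattice.sup_def[of ?B]
    using lub[OF that] sub.least_unique by (blast intro: some_equality)
  show "\<bottom>\<^bsub>?B\<^esub> = \<bottom>"
    unfolding bottom_def[of ?B] using bot sub.least_unique by (blast intro: some_equality)
  show "\<top>\<^bsub>?B\<^esub> = \<top>"
    unfolding top_def[of ?B] using top sub.greatest_unique by (blast intro: some_equality)
qed

lemma symmetric_iff:
  assumes S: "bounded_sublattice L S"
  shows "symmetric (L, S) \<longleftrightarrow> (\<forall>x \<in> S. \<exists>y \<in> S. is_complement L x y)"
proof -
  have closed: "S \<subseteq> carrier L" "\<And>x y. \<lbrakk>x \<in> S; y \<in> S\<rbrakk> \<Longrightarrow> x \<sqinter> y \<in> S \<and> x \<squnion> y \<in> S"
    using S by (auto simp: bounded_sublattice_def)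
  have "complemented (L\<lparr>carrier := S\<rparr>) x \<longleftrightarrow> (\<exists>y \<in> S. is_complement L x y)" if "x \<in> S" for x
    using that closed sublattice_ops[OF S] by (auto simp: complemented_def is_complement_def)
  moreover have "x \<sqinter> (y \<squnion> z) = (x \<sqinter> y) \<squnion> (x \<sqinter> z)" if "x \<in> S" "y \<in> S" "z \<in> S" for x y z
    using that closed(1) by (intro meet_join_distrib) auto
  ultimately show ?thesis
    using sublattice_ops[OF S] closed by (simp add: symmetric_def is_boolean_algebra_def)
qed

text \<open>
  For a complemented \<open>c\<close>, join-density writes its complement as \<open>\<Squnion>T\<close> with \<open>T \<subseteq> S\<close>, and symmetry
  provides the complements of the elements of \<open>T\<close> inside \<open>S\<close>. Then \<open>c\<close> is their meet, and this meet is
  strongly exact because \<open>\<Squnion>T\<close> has a complement, namely \<open>c\<close>.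
\<close>

lemma symmetric_strongly_exact_imp_eq_complemented_elements:
  assumes F: "Frith_frame (L, S)" and ex: "strongly_exact (L, S)" and sym: "symmetric (L, S)"
  shows "S = complemented_elements L"
proof
  have S: "bounded_sublattice L S" and gen: "join_generated_by L S"
    using F by (simp_all add: Frith_frame_def)
  have compl: "\<exists>y \<in> S. is_complement L x y" if "x \<in> S" for x
    using sym symmetric_iff[OF S] that by blast
  then show "S \<subseteq> complemented_elements L"
    unfolding subset_iff mem_complemented_elements by blast
  show "complemented_elements L \<subseteq> S"
  proof
    fix c assume "c \<in> complemented_elements L"
    then obtain d where cd: "is_complement L c d"
      by (auto simp: mem_complemented_elements)
    then obtain T where T: "T \<subseteq> S" "d = \<Squnion>T"
      using gen by (auto simp: join_generated_by_def is_complement_def)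
    let ?P = "{s \<in> S. \<exists>t \<in> T. is_complement L s t}"
    have PT: "elementwise_complements ?P T"
      unfolding elementwise_complements_def
    proof (intro conjI ballI)
      fix t assume t: "t \<in> T"
      then obtain s where "s \<in> S" "is_complement L t s" using T compl by (meson subsetD)
      then have "s \<in> S" "is_complement L s t" by (auto intro: is_complement_sym)
      then show "\<exists>s \<in> ?P. is_complement L s t" using t by blast
    qed simp
    have "strongly_exact_meet L ?P"
      using strongly_exact_meet_iff[OF PT] cd T by auto
    then have "\<Sqinter>?P \<in> S"
      using ex by (auto simp: strongly_exact_def)
    then show "c \<in> S"
      using Inf_eq_complement_of_Sup[OF PT] cd T by simp
  qed
qed

lemma strongly_exact_complemented_elements:
  "strongly_exact (L, complemented_elements L)"
  unfolding strongly_exact_def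
proof (clarify)
  fix P assume P: "P \<subseteq> complemented_elements L" and ex: "strongly_exact_meet L P"
  let ?T = "{t. \<exists>s \<in> P. is_complement L s t}"
  have PT: "elementwise_complements P ?T"
    using P unfolding elementwise_complements_def subset_iff mem_complemented_elements by blast
  obtain a where a: "is_complement L a (\<Squnion>?T)"
    using ex strongly_exact_meet_iff[OF PT] by blast
  then show "\<Sqinter>P \<in> complemented_elements L"
    using Inf_eq_complement_of_Sup[OF PT a] by (auto simp: mem_complemented_elements)
qed

lemma symmetric_complemented_elements: "symmetric (L, complemented_elements L)"
  using symmetric_iff[OF bounded_sublattice_complemented_elements] is_complement_sym
  by (meson mem_complemented_elements)

lemma zero_dimensional_iff_Frith_frame:
  "zero_dimensional L \<longleftrightarrow> Frith_frame (L, complemented_elements L)"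
  using bounded_sublattice_complemented_elements frame_axioms
  by (simp add: zero_dimensional_def Frith_frame_def complemented_elements_def)

end


section \<open>Categories of frames and of Frith frames\<close>

lemma category_full_subcategory: "category C \<Longrightarrow> category (full_subcategory C P)"
  unfolding category_def full_subcategory_def by simp

lemma frame_hom_ident:
  assumes "frame L" shows "restrict id (carrier L) \<in> frame_hom L L"
proof -
  interpret frame L by fact
  have "restrict id (carrier L) ` A = A" if "A \<subseteq> carrier L" for A
    using that by force
  then show ?thesis
    by (auto simp: frame_hom_def)
qed

lemma frame_hom_compose:
  assumes "frame L" and f: "f \<in> frame_hom L M" and g: "g \<in> frame_hom M N"
  shows "compose (carrier L) g f \<in> frame_hom L N"
proof -
  interpret frame L by fact
  have f_closed: "f x \<in> carrier M" if "x \<in> carrier L" for x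
    using f that by (auto simp: frame_hom_def)
  have g_closed: "g x \<in> carrier N" if "x \<in> carrier M" for x
    using g that by (auto simp: frame_hom_def)
  show ?thesis
    unfolding frame_hom_def
  proof (intro CollectI conjI ballI allI impI)
    show "compose (carrier L) g f \<in> carrier L \<rightarrow>\<^sub>E carrier N"
      by (simp add: PiE_def compose_def f_closed g_closed)
    show "compose (carrier L) g f \<top>\<^bsub>L\<^esub> = \<top>\<^bsub>N\<^esub>"
      using f g by (simp add: frame_hom_def compose_eq)
  next
    fix x y assume "x \<in> carrier L" "y \<in> carrier L"
    then show "compose (carrier L) g f (x \<sqinter>\<^bsub>L\<^esub> y) =
        compose (carrier L) g f x \<sqinter>\<^bsub>N\<^esub> compose (carrier L) g f y"
      using f g by (simp add: frame_hom_def compose_eq f_closed)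
  next
    fix A assume A: "A \<subseteq> carrier L"
    then have "f ` A \<subseteq> carrier M" and "compose (carrier L) g f ` A = g ` f ` A"
      using f_closed by (force simp: compose_eq)+
    then show "compose (carrier L) g f (\<Squnion>\<^bsub>L\<^esub>A) = \<Squnion>\<^bsub>N\<^esub>(compose (carrier L) g f ` A)"
      using f g A by (simp add: frame_hom_def compose_eq)
  qed
qed

lemma compose_ident_right:
  "f \<in> frame_hom L M \<Longrightarrow> compose (carrier L) f (restrict id (carrier L)) = f"
  by (auto simp: frame_hom_def compose_def fun_eq_iff PiE_def extensional_def)

lemma compose_ident_left:
  "f \<in> frame_hom L M \<Longrightarrow> compose (carrier L) (restrict id (carrier M)) f = f"
  by (auto simp: frame_hom_def compose_def fun_eq_iff PiE_def extensional_def Pi_def)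

lemma compose_frame_hom_assoc:
  "f \<in> frame_hom L M \<Longrightarrow>
    compose (carrier L) h (compose (carrier L) g f) =
    compose (carrier L) (compose (carrier M) h g) f"
  by (auto simp: frame_hom_def compose_def fun_eq_iff)

lemma category_Frame_cat: "category Frame_cat"
  by unfold_locales
    (auto simp: Frame_cat_def frame_hom_ident frame_hom_compose compose_ident_right
      compose_ident_left compose_frame_hom_assoc)

lemma category_Frith_cat: "category Frith_cat"
proof
  fix X :: "'a gorder \<times> 'a set" assume "X \<in> Ob Frith_cat"
  then show "Ident Frith_cat X \<in> Mor Frith_cat X X"
    by (cases X) (auto simp: Frith_cat_def Frith_frame_def Frith_hom_def frame_hom_ident
        bounded_sublattice_def subset_iff)
next
  fix X Y Z :: "'a gorder \<times> 'a set" and f g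
  assume "X \<in> Ob Frith_cat" "Y \<in> Ob Frith_cat" "Z \<in> Ob Frith_cat"
    "f \<in> Mor Frith_cat X Y" "g \<in> Mor Frith_cat Y Z"
  then show "Comp Frith_cat X Y Z g f \<in> Mor Frith_cat X Z"
    by (cases X; cases Y; cases Z)
      (auto simp: Frith_cat_def Frith_frame_def Frith_hom_def frame_hom_compose
        bounded_sublattice_def subset_iff compose_eq)
qed (auto simp: Frith_cat_def Frith_hom_def compose_ident_right compose_ident_left
    compose_frame_hom_assoc)

lemma frame_hom_is_complement:
  assumes "frame L" "frame M" and h: "h \<in> frame_hom L M" and xy: "is_complement L x y"
  shows "is_complement M (h x) (h y)"
proof -
  interpret L: frame L by fact
  interpret M: frame M by fact
  have Sup: "h (\<Squnion>\<^bsub>L\<^esub>A) = \<Squnion>\<^bsub>M\<^esub>(h ` A)" if "A \<subseteq> carrier L" for A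
    using h that by (simp add: frame_hom_def)
  have L_xy: "x \<in> carrier L" "y \<in> carrier L"
    using xy by (simp_all add: is_complement_def)
  have "h \<bottom>\<^bsub>L\<^esub> = \<bottom>\<^bsub>M\<^esub>"
    using Sup[of "{}"] by (simp add: L.sup_empty_eq M.sup_empty_eq)
  moreover have "h (x \<squnion>\<^bsub>L\<^esub> y) = h x \<squnion>\<^bsub>M\<^esub> h y"
    using Sup[of "{x, y}"] xy by (simp add: join_def is_complement_def)
  moreover have "h x \<in> carrier M" "h y \<in> carrier M" "h \<top>\<^bsub>L\<^esub> = \<top>\<^bsub>M\<^esub>"
    using h xy by (auto simp: frame_hom_def is_complement_def)
  moreover have "h (x \<sqinter>\<^bsub>L\<^esub> y) = h x \<sqinter>\<^bsub>M\<^esub> h y"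
    using h L_xy by (simp add: frame_hom_def)
  ultimately show ?thesis
    using xy by (simp add: is_complement_def)
qed

text \<open>
  As complements are preserved, the condition on the distinguished sublattices is automatic; this
  makes the functors of the equivalence full and faithful.
\<close>

lemma Frith_hom_complemented_elements:
  assumes "frame L" "frame M"
  shows "Frith_hom (L, complemented_elements L) (M, complemented_elements M) = frame_hom L M"
  using frame_hom_is_complement[OF assms]
  by (auto simp: Frith_hom_def mem_complemented_elements) blast

lemma Ob_ZeroDim_cat: "Ob ZeroDim_cat = {L. frame L \<and> zero_dimensional L}"
  by (auto simp: ZeroDim_cat_def full_subcategory_def Frame_cat_def)

lemma Ob_SESymFrith_cat:
  "Ob SESymFrith_cat = (\<lambda>L. (L, complemented_elements L)) ` Ob ZeroDim_cat"
proof (intro equalityI subsetI)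
  fix X :: "'a gorder \<times> 'a set" assume "X \<in> Ob SESymFrith_cat"
  then obtain L S where X: "X = (L, S)" "Frith_frame (L, S)" "strongly_exact (L, S)"
      "symmetric (L, S)"
    by (cases X) (auto simp: SESymFrith_cat_def full_subcategory_def Frith_cat_def)
  then interpret frame L by (simp add: Frith_frame_def)
  have "S = complemented_elements L"
    using X by (intro symmetric_strongly_exact_imp_eq_complemented_elements)
  then show "X \<in> (\<lambda>L. (L, complemented_elements L)) ` Ob ZeroDim_cat"
    using X frame_axioms zero_dimensional_iff_Frith_frame by (auto simp: Ob_ZeroDim_cat)
next
  fix X :: "'a gorder \<times> 'a set"
  assume "X \<in> (\<lambda>L. (L, complemented_elements L)) ` Ob ZeroDim_cat"
  then obtain L where X: "X = (L, complemented_elements L)" "frame L" "zero_dimensional L"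
    by (auto simp: Ob_ZeroDim_cat)
  then interpret frame L by simp
  show "X \<in> Ob SESymFrith_cat"
    using X zero_dimensional_iff_Frith_frame strongly_exact_complemented_elements
      symmetric_complemented_elements
    by (simp add: SESymFrith_cat_def full_subcategory_def Frith_cat_def)
qed


section \<open>The equivalence\<close>

lemma nat_iso_identI:
  assumes "category C"
    and "\<And>X. X \<in> Ob C \<Longrightarrow> on_ob F X = X" "\<And>X. X \<in> Ob C \<Longrightarrow> on_ob G X = X"
    and "\<And>X Y f. \<lbrakk>X \<in> Ob C; Y \<in> Ob C; f \<in> Mor C X Y\<rbrakk> \<Longrightarrow> on_mor F X Y f = f"
    and "\<And>X Y f. \<lbrakk>X \<in> Ob C; Y \<in> Ob C; f \<in> Mor C X Y\<rbrakk> \<Longrightarrow> on_mor G X Y f = f"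
  shows "nat_iso C C F G (Ident C)"
proof -
  interpret category C by fact
  show ?thesis
    unfolding nat_iso_def iso_arrow_def
    using assms(2-) ident_mor comp_ident_left comp_ident_right by (auto intro!: bexI)
qed

theorem proposition3p14:
  shows "equivalent_categories
    (ZeroDim_cat :: ('a gorder, 'a \<Rightarrow> 'a) cat)
    (SESymFrith_cat :: ('a gorder \<times> 'a set, 'a \<Rightarrow> 'a) cat)"
proof -
  let ?C = "ZeroDim_cat :: ('a gorder, 'a \<Rightarrow> 'a) cat"
  let ?D = "SESymFrith_cat :: ('a gorder \<times> 'a set, 'a \<Rightarrow> 'a) cat"
  let ?F = "\<lparr>on_ob = (\<lambda>L. (L, complemented_elements L)), on_mor = (\<lambda>X Y f. f)\<rparr>
    :: ('a gorder, 'a \<Rightarrow> 'a, 'a gorder \<times> 'a set, 'a \<Rightarrow> 'a) fctr"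
  let ?G = "\<lparr>on_ob = fst, on_mor = (\<lambda>X Y f. f)\<rparr>
    :: ('a gorder \<times> 'a set, 'a \<Rightarrow> 'a, 'a gorder, 'a \<Rightarrow> 'a) fctr"
  have C: "category ?C" and D: "category ?D"
    by (simp_all add: ZeroDim_cat_def SESymFrith_cat_def category_full_subcategory
        category_Frame_cat category_Frith_cat)
  have frame: "frame L" if "L \<in> Ob ?C" for L
    using that by (simp add: Ob_ZeroDim_cat)
  have C_simps: "Mor ?C = frame_hom" "Ident ?C = (\<lambda>L. restrict id (carrier L))"
      "Comp ?C = (\<lambda>L M N g f. compose (carrier L) g f)"
    by (simp_all add: ZeroDim_cat_def full_subcategory_def Frame_cat_def)
  have D_simps: "Mor ?D = Frith_hom" "Ident ?D = (\<lambda>X. restrict id (carrier (fst X)))"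
      "Comp ?D = (\<lambda>X Y Z g f. compose (carrier (fst X)) g f)"
    by (simp_all add: SESymFrith_cat_def full_subcategory_def Frith_cat_def)
  have F: "is_functor ?C ?D ?F"
    using frame by (auto simp: is_functor_def Ob_SESymFrith_cat C_simps D_simps
        Frith_hom_complemented_elements)
  have G: "is_functor ?D ?C ?G"
    using frame by (auto simp: is_functor_def Ob_SESymFrith_cat C_simps D_simps
        Frith_hom_complemented_elements)
  have "nat_iso ?C ?C id_functor (comp_functor ?G ?F) (Ident ?C)"
    by (rule nat_iso_identI[OF C]) (simp_all add: id_functor_def comp_functor_def)
  moreover have "nat_iso ?D ?D (comp_functor ?F ?G) id_functor (Ident ?D)"
    by (rule nat_iso_identI[OF D]) (auto simp: id_functor_def comp_functor_def Ob_SESymFrith_cat)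
  ultimately show ?thesis
    unfolding equivalent_categories_def using C D F G by blast
qed

end
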